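(* Let $G=(V,E,\omega,m)$ be a finite connected weighted graph, $n$ a positive integer, $f_1,\dots,f_n:V\to\mathbb{R}$ and $c\in\mathbb{R}$. Assume that $\overline{f_1}\neq0$ in the case $c=0$. Then the solutions $u:V\to\mathbb{R}$ of $$-\Delta u(x)=\sum_{i=1}^n f_i(x)e^{iu(x)}+c,\qquad x\in V,$$ are uniformly bounded, i.e. there is a constant $C$ (depending on $G,n,f_1,\dots,f_n,c$) such that every solution $u$ satisfies $\max_{x\in V}|u(x)|\leqslant C$.
   Context: A finite connected weighted graph $G=(V,E,\omega,m)$ consists of a finite connected graph $(V,E)$, a positive vertex weight $m:V\to(0,\infty)$, and a symmetric edge weight $\omega:V\times V\to[0,\infty)$, $\omega_{xy}=\omega_{yx}$, with $\omega_{xy}>0$ if and only if $\{x,y\}\in E$ (written $x\sim y$). The graph Laplacian is $\Delta u(x)=\frac{1}{m(x)}\sum_{y\sim x}\omega_{xy}(u(y)-u(x))$. The average of $f:V\to\mathbb{R}$ is $\overline f=\frac{\sum_{x\in V}m(x)f(x)}{\sum_{x\in V}m(x)}$. *)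

theory Defs
  imports Complex_Main "Graph_Theory.Graph_Theory"
begin

text \<open>
  Undirected edges are encoded by symmetric arcs: \<open>{x, y}\<close> is an edge of \<open>G\<close> iff
  \<open>(x, y) \<in> parcs G\<close>, equivalently \<open>(y, x) \<in> parcs G\<close>; there are no parallel edges.
  Loops are not excluded, which covers both conventions for the word graph: a loop at \<open>x\<close>
  contributes \<open>\<omega> x x * (u x - u x) = 0\<close> to the Laplacian below.
  The library notion of connectedness includes that the vertex set is nonempty.
\<close>

locale finite_connected_weighted_graph = pair_pseudo_graph G
  for G :: "'a pair_pre_digraph" +
  fixes \<omega> :: "'a \<Rightarrow> 'a \<Rightarrow> real" and m :: "'a \<Rightarrow> real"
  assumes connected: "connected (with_proj G)"
    and vertex_weight_pos: "x \<in> pverts G \<Longrightarrow> m x > 0"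
    and edge_weight_nonneg: "x \<in> pverts G \<Longrightarrow> y \<in> pverts G \<Longrightarrow> \<omega> x y \<ge> 0"
    and edge_weight_sym: "x \<in> pverts G \<Longrightarrow> y \<in> pverts G \<Longrightarrow> \<omega> x y = \<omega> y x"
    and edge_weight_pos_iff:
      "x \<in> pverts G \<Longrightarrow> y \<in> pverts G \<Longrightarrow> \<omega> x y > 0 \<longleftrightarrow> (x, y) \<in> parcs G"

definition graph_laplacian ::
  "'a pair_pre_digraph \<Rightarrow> ('a \<Rightarrow> 'a \<Rightarrow> real) \<Rightarrow> ('a \<Rightarrow> real) \<Rightarrow> ('a \<Rightarrow> real) \<Rightarrow> 'a \<Rightarrow> real" where
  "graph_laplacian G \<omega> m u x =
     1 / m x * (\<Sum>y \<in> {y \<in> pverts G. (x, y) \<in> parcs G}. \<omega> x y * (u y - u x))"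

definition graph_average ::
  "'a pair_pre_digraph \<Rightarrow> ('a \<Rightarrow> real) \<Rightarrow> ('a \<Rightarrow> real) \<Rightarrow> real" where
  "graph_average G m f = (\<Sum>x \<in> pverts G. m x * f x) / (\<Sum>x \<in> pverts G. m x)"

end

theory Submission
  imports Defs
begin

text \<open>
  Suppose solutions \<open>u k\<close> satisfy \<open>M k = max \<bar>u k\<bar> \<rightarrow> \<infinity>\<close>. Along a subsequence \<open>u k / M k\<close> converges
  to some \<open>w\<close> with \<open>max \<bar>w\<bar> = 1\<close>. Dividing the equation by \<open>M k\<close> shows that \<open>w\<close> is harmonic
  wherever \<open>w \<noteq> 0\<close>, and that all \<open>f i\<close> vanish wherever \<open>w > 0\<close>, since the exponentials grow faster
  than \<open>M k\<close>. If \<open>w\<close> is positive somewhere, the maximum principle makes it a positive constant, so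
  every \<open>f i\<close> vanishes and integration gives \<open>c = 0\<close>, which is excluded. Otherwise \<open>w\<close> is a negative
  constant, so \<open>u k \<rightarrow> -\<infinity>\<close> at every vertex. Integrating gives \<open>c = 0\<close>; testing the equation
  against \<open>u k\<close> shows that the Dirichlet energy of \<open>u k\<close> tends to 0, hence so do the differences
  \<open>u k x - u k y\<close>; and dividing the integrated equation by \<open>exp (u k x0)\<close> leaves mean value 0
  for \<open>f 1\<close> in the limit.
\<close>

section \<open>Limits of sequences: compactness and exponential growth\<close>

text \<open>Bolzano-Weierstrass one coordinate at a time: each new point costs a further
  subsequence, chosen monotone there, and bounded monotone sequences converge.\<close>

lemma finite_convergent_subseq:
  fixes v :: "nat \<Rightarrow> 'b \<Rightarrow> real"
  assumes "finite V" and "\<And>k x. x \<in> V \<Longrightarrow> \<bar>v k x\<bar> \<le> B"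
  shows "\<exists>s. strict_mono s \<and> (\<forall>x\<in>V. convergent (\<lambda>k. v (s k) x))"
  using assms
proof (induction V rule: finite_induct)
  case empty
  show ?case by (rule exI[of _ id]) (simp add: strict_mono_def)
next
  case (insert a V)
  then obtain s where s: "strict_mono s" "\<forall>x\<in>V. convergent (\<lambda>k. v (s k) x)" by auto
  obtain r :: "nat \<Rightarrow> nat" where r: "strict_mono r" "monoseq (\<lambda>k. v (s (r k)) a)"
    using seq_monosub[of "\<lambda>k. v (s k) a"] by auto
  have "Bseq (\<lambda>k. v (s (r k)) a)"
    by (rule BseqI'[of _ B]) (use insert.prems in auto)
  then have "convergent (\<lambda>k. v (s (r k)) a)"
    using r(2) by (rule Bseq_monoseq_convergent)
  moreover have "convergent (\<lambda>k. v (s (r k)) x)" if "x \<in> V" for x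
    using convergent_subseq_convergent[OF s(2)[rule_format, OF that] r(1)] by (simp add: o_def)
  ultimately show ?case
    using strict_mono_o[OF s(1) r(1)] by (intro exI[of _ "s \<circ> r"]) (auto simp: o_def)
qed

text \<open>Coefficients are removed from the top. Multiplying the convergent quotient by
  \<open>M k * exp (- real (Suc n) * (M k * v k))\<close>, which tends to 0, isolates the leading
  coefficient. It is therefore 0, and the induction hypothesis applies with the same
  \<open>D\<close>.\<close>

lemma exp_sum_coeffs_zero:
  fixes M v a :: "nat \<Rightarrow> real"
  assumes M: "filterlim M at_top sequentially" and v: "v \<longlonglongrightarrow> l" and l: "l > 0"
    and D: "(\<lambda>k. ((\<Sum>i = 1..n. a i * exp (real i * (M k * v k))) + c) / M k) \<longlonglongrightarrow> D"
  shows "\<forall>i\<in>{1..n}. a i = 0"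
  using D
proof (induction n)
  case 0
  show ?case by simp
next
  case (Suc n)
  have y: "filterlim (\<lambda>k. M k * v k) at_top sequentially"
    using filterlim_tendsto_pos_mult_at_top[OF v l M] by (simp add: mult.commute)
  have e0: "(\<lambda>k. exp (- p * (M k * v k))) \<longlonglongrightarrow> 0" if "p > 0" for p
    by (rule filterlim_compose[OF exp_at_bot])
      (use filterlim_tendsto_neg_mult_at_bot[OF tendsto_const _ y, of "-p"] that in simp)
  \<comment> \<open>Taking \<open>x = M k * v k\<close> and then dividing by \<open>v k\<close>,
    whose limit is nonzero, shows that \<open>exp (- (M k * v k))\<close> beats the factor
    \<open>M k\<close>.\<close>
  have "((\<lambda>x::real. x ^ 1 / exp x) \<longlongrightarrow> 0) at_top" by (rule tendsto_power_div_exp_0)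
  then have "(\<lambda>k. (M k * v k) ^ 1 / exp (M k * v k)) \<longlonglongrightarrow> 0"
    by (rule filterlim_compose[OF _ y])
  from tendsto_divide[OF this v] l
  have "(\<lambda>k. ((M k * v k) ^ 1 / exp (M k * v k)) / v k) \<longlonglongrightarrow> 0" by simp
  then have "(\<lambda>k. M k * exp (- (M k * v k))) \<longlonglongrightarrow> 0"
    by (rule Lim_transform_eventually)
      (use order_tendstoD(1)[OF v l] in \<open>auto elim!: eventually_mono simp: exp_minus divide_inverse\<close>)
  \<comment> \<open>The \<open>n\<close>-th power only has to converge (it is constantly 1 for
    \<open>n = 0\<close>); the decay comes from the factor
    \<open>M k * exp (- (M k * v k))\<close>.\<close>
  from tendsto_mult[OF this tendsto_mult[OF tendsto_power[OF e0[of 1], of n] Suc.prems]]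
  have *: "(\<lambda>k. M k * exp (- (M k * v k)) * (exp (- 1 * (M k * v k)) ^ n *
      (((\<Sum>i = 1..Suc n. a i * exp (real i * (M k * v k))) + c) / M k))) \<longlonglongrightarrow> 0"
    by simp
  have lim0: "(\<lambda>k. exp (- real (Suc n) * (M k * v k)) *
      ((\<Sum>i = 1..Suc n. a i * exp (real i * (M k * v k))) + c)) \<longlonglongrightarrow> 0"
  proof (rule Lim_transform_eventually[OF *])
    have "\<forall>\<^sub>F k in sequentially. M k > 0" using M by (simp add: filterlim_at_top_dense)
    then show "\<forall>\<^sub>F k in sequentially. M k * exp (- (M k * v k)) * (exp (- 1 * (M k * v k)) ^ n *
        (((\<Sum>i = 1..Suc n. a i * exp (real i * (M k * v k))) + c) / M k)) =
      exp (- real (Suc n) * (M k * v k)) * ((\<Sum>i = 1..Suc n. a i * exp (real i * (M k * v k))) + c)"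
    proof eventually_elim
      case (elim k)
      have "exp (- real (Suc n) * (M k * v k)) = exp (- (M k * v k)) * exp (- 1 * (M k * v k)) ^ n"
        by (simp add: exp_of_nat_mult[symmetric] mult_exp_exp algebra_simps)
      then show ?case using elim by simp
    qed
  qed
  \<comment> \<open>The product from \<open>lim0\<close> multiplied out: every term except the
    leading one decays.\<close>
  have "(\<lambda>k. (\<Sum>i = 1..n. a i * exp (- (real (Suc n) - real i) * (M k * v k))) + a (Suc n)
      + c * exp (- real (Suc n) * (M k * v k))) \<longlonglongrightarrow> (\<Sum>i = 1..n. a i * 0) + a (Suc n) + c * 0"
    by (intro tendsto_intros e0) auto
  also have "(\<lambda>k. (\<Sum>i = 1..n. a i * exp (- (real (Suc n) - real i) * (M k * v k))) + a (Suc n)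
      + c * exp (- real (Suc n) * (M k * v k))) = (\<lambda>k. exp (- real (Suc n) * (M k * v k)) *
      ((\<Sum>i = 1..Suc n. a i * exp (real i * (M k * v k))) + c))"
  proof
    fix k
    have "exp (- real (Suc n) * Y) * exp (real i * Y) = exp (- (real (Suc n) - real i) * Y)" for i Y
      by (simp add: mult_exp_exp algebra_simps)
    note E = this
    have "exp (- real (Suc n) * Y) * ((\<Sum>i = 1..Suc n. a i * exp (real i * Y)) + c) =
      (\<Sum>i = 1..Suc n. a i * (exp (- real (Suc n) * Y) * exp (real i * Y))) + c * exp (- real (Suc n) * Y)" for Y
      by (simp add: distrib_left sum_distrib_left mult_ac del: sum.cl_ivl_Suc)
    then show "(\<Sum>i = 1..n. a i * exp (- (real (Suc n) - real i) * (M k * v k))) + a (Suc n)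
      + c * exp (- real (Suc n) * (M k * v k)) = exp (- real (Suc n) * (M k * v k)) *
      ((\<Sum>i = 1..Suc n. a i * exp (real i * (M k * v k))) + c)"
      unfolding E by simp
  qed
  finally have top: "a (Suc n) = 0"
    using LIMSEQ_unique[OF lim0] by simp
  with Suc.IH Suc.prems have "\<forall>i\<in>{1..n}. a i = 0" by simp
  with top show ?case by (auto simp: le_Suc_eq)
qed

section \<open>Laplacian calculus: Green's identity, maximum principles, Dirichlet energy\<close>

context finite_connected_weighted_graph
begin

text \<open>Non-adjacent pairs have weight 0. Summing over all vertices gives a range independent of
  \<open>x\<close>, so double sums can be swapped.\<close>

lemma graph_laplacian_eq:
  assumes "x \<in> pverts G"
  shows "graph_laplacian G \<omega> m u x = (\<Sum>y\<in>pverts G. \<omega> x y * (u y - u x)) / m x"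
proof -
  have "(\<Sum>y \<in> {y \<in> pverts G. (x, y) \<in> parcs G}. \<omega> x y * (u y - u x))
    = (\<Sum>y\<in>pverts G. \<omega> x y * (u y - u x))"
    by (rule sum.mono_neutral_left)
      (use assms edge_weight_nonneg edge_weight_pos_iff pair_finite_verts in
        \<open>auto simp: less_le\<close>)
  then show ?thesis by (simp add: graph_laplacian_def)
qed

text \<open>Connectedness as an induction rule. The library defines it through the symmetric
  closure, which has the same reachability because the arcs are already symmetric.\<close>

lemma arc_induct:
  assumes "x \<in> pverts G" "y \<in> pverts G" "P x"
    and step: "\<And>x y. x \<in> pverts G \<Longrightarrow> y \<in> pverts G \<Longrightarrow> (x, y) \<in> parcs G \<Longrightarrow> P x \<Longrightarrow> P y"
  shows "P y"
proof -
  have "x \<rightarrow>\<^sup>*\<^bsub>with_proj (mk_symmetric (with_proj G))\<^esub> y"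
    using connected assms(1,2) by (auto simp: connected_def strongly_connected_def)
  then have "x \<rightarrow>\<^sup>*\<^bsub>with_proj G\<^esub> y"
    using reachable_mk_symmetric_eq[OF pair_sym_arcs] by simp
  then show ?thesis
  proof (induction rule: reachable_induct)
    case base
    show ?case by fact
  next
    case (step a b)
    then show ?case
      using assms(4)[of a b] adj_in_verts by auto
  qed
qed

lemma pverts_nonempty: "pverts G \<noteq> {}"
  using connected by (auto simp: connected_def strongly_connected_def)

lemma total_weight_pos: "(\<Sum>x\<in>pverts G. m x) > 0"
  by (rule sum_pos) (use pair_finite_verts pverts_nonempty vertex_weight_pos in auto)

text \<open>Green's identity; the factor 1/2 appears because each edge is counted in both
  directions.\<close>

lemma sum_laplacian_mult:
  "(\<Sum>x\<in>pverts G. m x * (u x * graph_laplacian G \<omega> m v x)) =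
    - (\<Sum>x\<in>pverts G. \<Sum>y\<in>pverts G. \<omega> x y * ((u y - u x) * (v y - v x))) / 2"
proof -
  let ?V = "pverts G"
  let ?S = "\<Sum>x\<in>?V. \<Sum>y\<in>?V. \<omega> x y * (u x * (v y - v x))"
  let ?T = "\<Sum>x\<in>?V. \<Sum>y\<in>?V. \<omega> x y * (u y * (v x - v y))"
  have "(\<Sum>x\<in>?V. m x * (u x * graph_laplacian G \<omega> m v x)) = ?S"
  proof (rule sum.cong)
    fix x assume x: "x \<in> ?V"
    have "m x * (u x * graph_laplacian G \<omega> m v x) = u x * (\<Sum>y\<in>?V. \<omega> x y * (v y - v x))"
      using vertex_weight_pos[OF x] by (simp add: graph_laplacian_eq[OF x])
    also have "\<dots> = (\<Sum>y\<in>?V. \<omega> x y * (u x * (v y - v x)))"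
      by (simp add: sum_distrib_left mult.left_commute)
    finally show "m x * (u x * graph_laplacian G \<omega> m v x) = (\<Sum>y\<in>?V. \<omega> x y * (u x * (v y - v x)))" .
  qed simp
  \<comment> \<open>Exchanging the roles of \<open>x\<close> and \<open>y\<close> by symmetry of
    \<open>\<omega>\<close>; the mean of the two forms is symmetric in both differences.\<close>
  moreover have "?S = ?T"
    by (subst sum.swap) (use edge_weight_sym in \<open>auto intro!: sum.cong\<close>)
  moreover have "?S + ?T = - (\<Sum>x\<in>?V. \<Sum>y\<in>?V. \<omega> x y * ((u y - u x) * (v y - v x)))"
    by (simp add: sum.distrib[symmetric] sum_negf[symmetric] algebra_simps)
  ultimately show ?thesis by simp
qed

lemma sum_laplacian: "(\<Sum>x\<in>pverts G. m x * graph_laplacian G \<omega> m u x) = 0"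
  using sum_laplacian_mult[of "\<lambda>_. 1"] by simp

lemma laplacian_tendsto:
  assumes "\<And>y. y \<in> pverts G \<Longrightarrow> ((\<lambda>k. u k y) \<longlongrightarrow> w y) F" "x \<in> pverts G"
  shows "((\<lambda>k. graph_laplacian G \<omega> m (u k) x) \<longlongrightarrow> graph_laplacian G \<omega> m w x) F"
  unfolding graph_laplacian_eq[OF assms(2)]
  by (intro tendsto_intros assms) (use vertex_weight_pos[OF assms(2)] in auto)

lemma laplacian_divide:
  "graph_laplacian G \<omega> m (\<lambda>y. u y / r) x = graph_laplacian G \<omega> m u x / r"
  by (simp add: graph_laplacian_def sum_divide_distrib mult.commute flip: diff_divide_distrib)

text \<open>At a maximum the Laplacian is a weighted sum of terms of one sign, so its vanishing
  forces equality at all neighbours, and connectedness spreads it. Harmonicity is asked only where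
  the maximum is attained, since the blow-up limit is known to be harmonic only where it is
  nonzero.\<close>

lemma maximum_principle:
  assumes x: "x \<in> pverts G" and y: "y \<in> pverts G"
    and max: "\<And>z. z \<in> pverts G \<Longrightarrow> w z \<le> w x"
    and lap: "\<And>z. z \<in> pverts G \<Longrightarrow> w z = w x \<Longrightarrow> graph_laplacian G \<omega> m w z = 0"
  shows "w y = w x"
  using x y
proof (rule arc_induct[where P = "\<lambda>z. w z = w x"])
  fix a b
  assume ab: "a \<in> pverts G" "b \<in> pverts G" "(a, b) \<in> parcs G" "w a = w x"
  have "(\<Sum>z\<in>pverts G. \<omega> a z * (w a - w z)) = 0"
    using lap[OF ab(1,4)] vertex_weight_pos[OF ab(1)]
    by (simp add: graph_laplacian_eq[OF ab(1)] right_diff_distrib sum_subtractf)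
  moreover have "\<omega> a z * (w a - w z) \<ge> 0" if "z \<in> pverts G" for z
    using edge_weight_nonneg[OF ab(1) that] max[OF that] ab(4) by simp
  ultimately have "\<omega> a b * (w a - w b) = 0"
    using ab(2) pair_finite_verts by (simp add: sum_nonneg_eq_0_iff)
  moreover have "\<omega> a b > 0" using edge_weight_pos_iff ab by simp
  ultimately show "w b = w x" using ab(4) by simp
qed simp

lemma minimum_principle:
  assumes "x \<in> pverts G" "y \<in> pverts G"
    and "\<And>z. z \<in> pverts G \<Longrightarrow> w x \<le> w z"
    and "\<And>z. z \<in> pverts G \<Longrightarrow> w z = w x \<Longrightarrow> graph_laplacian G \<omega> m w z = 0"
  shows "w y = w x"
  \<comment> \<open>Negation is written as division by -1 so that \<open>laplacian_divide\<close>
    rewrites its Laplacian.\<close>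
  using maximum_principle[of x y "\<lambda>z. w z / (-1)"] assms unfolding laplacian_divide by simp

text \<open>By Green's identity the assumption says that the Dirichlet energy tends to 0. The energy
  dominates the squared difference along each edge up to the positive edge weight, and differences
  add up along paths.\<close>

lemma differences_vanish:
  assumes lap: "(\<lambda>k. \<Sum>x\<in>pverts G. m x * (u k x * graph_laplacian G \<omega> m (u k) x)) \<longlonglongrightarrow> 0"
    and x: "x \<in> pverts G" and y: "y \<in> pverts G"
  shows "(\<lambda>k. u k y - u k x) \<longlonglongrightarrow> 0"
  using x y
proof (rule arc_induct[where P = "\<lambda>z. (\<lambda>k. u k z - u k x) \<longlonglongrightarrow> 0"])
  fix a b
  assume ab: "a \<in> pverts G" "b \<in> pverts G" "(a, b) \<in> parcs G" "(\<lambda>k. u k a - u k x) \<longlonglongrightarrow> 0"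
  have pos: "\<omega> a b > 0" using edge_weight_pos_iff ab by simp
  have nn: "\<omega> p q * ((u k q - u k p) * (u k q - u k p)) \<ge> 0"
    if "p \<in> pverts G" "q \<in> pverts G" for p q k
    using edge_weight_nonneg that by simp
  have lim: "(\<lambda>k. \<Sum>p\<in>pverts G. \<Sum>q\<in>pverts G. \<omega> p q * ((u k q - u k p) * (u k q - u k p))) \<longlonglongrightarrow> 0"
    using tendsto_mult[OF tendsto_const[of "-2"] lap] unfolding sum_laplacian_mult by simp
  have le: "\<omega> a b * ((u k b - u k a) * (u k b - u k a)) \<le>
      (\<Sum>p\<in>pverts G. \<Sum>q\<in>pverts G. \<omega> p q * ((u k q - u k p) * (u k q - u k p)))" for k
  proof -
    have "\<omega> a b * ((u k b - u k a) * (u k b - u k a)) \<le>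
      (\<Sum>q\<in>pverts G. \<omega> a q * ((u k q - u k a) * (u k q - u k a)))"
      using ab pair_finite_verts nn
      by (intro member_le_sum[where f = "\<lambda>q. \<omega> a q * ((u k q - u k a) * (u k q - u k a))"]) auto
    also have "\<dots> \<le> (\<Sum>p\<in>pverts G. \<Sum>q\<in>pverts G. \<omega> p q * ((u k q - u k p) * (u k q - u k p)))"
      using ab pair_finite_verts nn
      by (intro member_le_sum[where f = "\<lambda>p. \<Sum>q\<in>pverts G. \<omega> p q * ((u k q - u k p) * (u k q - u k p))"]
          sum_nonneg) auto
    finally show ?thesis .
  qed
  have "(\<lambda>k. \<omega> a b * ((u k b - u k a) * (u k b - u k a))) \<longlonglongrightarrow> 0"
    by (rule tendsto_sandwich[OF always_eventually always_eventually tendsto_const lim])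
      (use nn[OF ab(1,2)] le in blast)+
  from tendsto_mult[OF tendsto_const[of "1 / \<omega> a b"] this] pos
  have "(\<lambda>k. (u k b - u k a)\<^sup>2) \<longlonglongrightarrow> 0" by (simp add: power2_eq_square)
  then have "(\<lambda>k. u k b - u k a) \<longlonglongrightarrow> 0"
    using tendsto_real_sqrt[of "\<lambda>k. (u k b - u k a)\<^sup>2" 0 sequentially]
    by (simp add: tendsto_rabs_zero_iff)
  from tendsto_add[OF this ab(4)] show "(\<lambda>k. u k b - u k x) \<longlonglongrightarrow> 0" by simp
qed simp

section \<open>Solutions escaping to minus infinity\<close>

lemma no_solutions_to_at_bot:
  fixes u :: "nat \<Rightarrow> 'a \<Rightarrow> real"
  assumes sol: "\<And>k x. x \<in> pverts G \<Longrightarrow>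
      - graph_laplacian G \<omega> m (u k) x = (\<Sum>i = 1..n. f i x * exp (real i * u k x)) + c"
    and bot: "\<And>x. x \<in> pverts G \<Longrightarrow> filterlim (\<lambda>k. u k x) at_bot sequentially"
    and n: "n > 0"
  shows "c = 0" "(\<Sum>x\<in>pverts G. m x * f 1 x) = 0"
proof -
  let ?V = "pverts G"
  have e0: "(\<lambda>k. exp (real i * u k x)) \<longlonglongrightarrow> 0" if "x \<in> ?V" "i > 0" for x i
    by (rule filterlim_compose[OF exp_at_bot])
      (rule filterlim_tendsto_pos_mult_at_bot[OF tendsto_const _ bot], use that in auto)
  \<comment> \<open>Integrating the equation kills the Laplacian; the limit of this identity leaves
    only \<open>c\<close> times the total weight.\<close>
  have int: "(\<Sum>x\<in>?V. m x * ((\<Sum>i = 1..n. f i x * exp (real i * u k x)) + c)) = 0" for k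
  proof -
    have "(\<Sum>x\<in>?V. m x * ((\<Sum>i = 1..n. f i x * exp (real i * u k x)) + c)) =
        - (\<Sum>x\<in>?V. m x * graph_laplacian G \<omega> m (u k) x)"
      unfolding sum_negf[symmetric] by (rule sum.cong) (simp_all only: sol[symmetric] mult_minus_right)
    then show ?thesis by (simp add: sum_laplacian)
  qed
  have "(\<lambda>k. \<Sum>x\<in>?V. m x * ((\<Sum>i = 1..n. f i x * exp (real i * u k x)) + c))
      \<longlonglongrightarrow> (\<Sum>x\<in>?V. m x * ((\<Sum>i = 1..n. f i x * 0) + c))"
    by (intro tendsto_intros e0) auto
  then have "(\<Sum>x\<in>?V. m x * c) = 0"
    unfolding int by (simp add: LIMSEQ_const_iff)
  then show c: "c = 0"
    using total_weight_pos by (simp add: sum_distrib_right[symmetric])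
  \<comment> \<open>These are the terms that arise when the equation is tested against
    \<open>u k\<close>. Splitting off one \<open>exp (u k x)\<close> absorbs the factor
    \<open>u k x\<close>; the rest converges, to 1 if \<open>i = 1\<close> and to 0
    otherwise.\<close>
  have ue: "(\<lambda>k. u k x * exp (real i * u k x)) \<longlonglongrightarrow> 0" if x: "x \<in> ?V" and "i > 0" for x i
  proof -
    have "filterlim (\<lambda>k. - u k x) at_top sequentially"
      using bot[OF x] by (simp add: filterlim_uminus_at_top)
    from filterlim_compose[OF tendsto_power_div_exp_0[of 1] this]
    have "(\<lambda>k. - (u k x * exp (u k x))) \<longlonglongrightarrow> 0" by (simp add: exp_minus field_simps)
    from tendsto_minus[OF this] have a: "(\<lambda>k. u k x * exp (u k x)) \<longlonglongrightarrow> 0" by simp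
    have "(\<lambda>k. exp (real (i - 1) * u k x)) \<longlonglongrightarrow> (if i = 1 then 1 else 0)"
      using e0[OF x, of "i - 1"] that by auto
    from tendsto_mult[OF a this]
    have "(\<lambda>k. u k x * exp (u k x) * exp (real (i - 1) * u k x)) \<longlonglongrightarrow> 0" by simp
    moreover have "exp (u k x) * exp (real (i - 1) * u k x) = exp (real i * u k x)" for k
      using that by (simp add: mult_exp_exp of_nat_diff algebra_simps)
    ultimately show ?thesis by (simp add: mult.assoc)
  qed
  have lap: "graph_laplacian G \<omega> m (u k) x = - (\<Sum>i = 1..n. f i x * exp (real i * u k x))"
    if "x \<in> ?V" for k x
    using sol[OF that, of k] c by simp
  have "(\<lambda>k. \<Sum>x\<in>?V. m x * (- (\<Sum>i = 1..n. f i x * (u k x * exp (real i * u k x)))))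
      \<longlonglongrightarrow> (\<Sum>x\<in>?V. m x * (- (\<Sum>i = 1..n. f i x * 0)))"
    by (intro tendsto_intros ue) auto
  moreover have "(\<Sum>x\<in>?V. m x * (- (\<Sum>i = 1..n. f i x * (u k x * exp (real i * u k x))))) =
      (\<Sum>x\<in>?V. m x * (u k x * graph_laplacian G \<omega> m (u k) x))" for k
    by (rule sum.cong) (simp_all add: lap sum_distrib_left mult_ac)
  ultimately have energy: "(\<lambda>k. \<Sum>x\<in>?V. m x * (u k x * graph_laplacian G \<omega> m (u k) x)) \<longlonglongrightarrow> 0"
    by simp
  obtain x0 where x0: "x0 \<in> ?V" using pverts_nonempty by auto
  \<comment> \<open>Normalising by the value at one fixed vertex works at all vertices because
    differences vanish; only the power \<open>i = 1\<close> survives.\<close>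
  have E: "(\<lambda>k. exp (real i * u k x - u k x0)) \<longlonglongrightarrow> (if i = 1 then 1 else 0)"
    if x: "x \<in> ?V" and "i > 0" for x i
  proof -
    have "(\<lambda>k. exp (u k x - u k x0)) \<longlonglongrightarrow> exp 0"
      by (intro tendsto_exp differences_vanish[OF energy] x0 x)
    moreover have "(\<lambda>k. exp (real (i - 1) * u k x)) \<longlonglongrightarrow> (if i = 1 then 1 else 0)"
      using e0[OF x, of "i - 1"] that by auto
    ultimately have "(\<lambda>k. exp (u k x - u k x0) * exp (real (i - 1) * u k x)) \<longlonglongrightarrow> exp 0 * (if i = 1 then 1 else 0)"
      by (rule tendsto_mult)
    moreover have "exp (u k x - u k x0) * exp (real (i - 1) * u k x) = exp (real i * u k x - u k x0)" for k
      using that by (simp add: mult_exp_exp of_nat_diff algebra_simps)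
    ultimately show ?thesis by simp
  qed
  have "(\<lambda>k. \<Sum>x\<in>?V. m x * (\<Sum>i = 1..n. f i x * exp (real i * u k x - u k x0)))
      \<longlonglongrightarrow> (\<Sum>x\<in>?V. m x * (\<Sum>i = 1..n. f i x * (if i = 1 then 1 else 0)))"
    by (intro tendsto_intros E) auto
  moreover have "(\<Sum>x\<in>?V. m x * (\<Sum>i = 1..n. f i x * exp (real i * u k x - u k x0))) = 0" for k
  proof -
    have "(\<Sum>x\<in>?V. m x * (\<Sum>i = 1..n. f i x * exp (real i * u k x - u k x0))) =
      (\<Sum>x\<in>?V. m x * (\<Sum>i = 1..n. f i x * exp (real i * u k x))) / exp (u k x0)"
      by (simp add: exp_diff flip: sum_divide_distrib)
    then show ?thesis using int[of k] c by simp
  qed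
  ultimately have "(\<Sum>x\<in>?V. m x * (\<Sum>i = 1..n. f i x * (if i = 1 then 1 else 0))) = 0"
    by (simp add: LIMSEQ_const_iff)
  moreover have "(\<Sum>i = 1..n. f i x * (if i = 1 then 1 else 0)) = f 1 x" for x
    using n by (simp add: if_distrib cong: if_cong)
  ultimately show "(\<Sum>x\<in>?V. m x * f 1 x) = 0" by simp
qed

section \<open>The blow-up argument\<close>

lemma solutions_bounded:
  fixes n :: nat
  assumes n: "n > 0" and f1: "c = 0 \<Longrightarrow> graph_average G m (f 1) \<noteq> 0"
  shows "\<exists>C. \<forall>u. (\<forall>x\<in>pverts G. - graph_laplacian G \<omega> m u x =
        (\<Sum>i = 1..n. f i x * exp (real i * u x)) + c)
      \<longrightarrow> (MAX x\<in>pverts G. \<bar>u x\<bar>) \<le> C"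
proof (rule ccontr)
  let ?V = "pverts G"
  let ?lap = "graph_laplacian G \<omega> m"
  note fin = pair_finite_verts and ne = pverts_nonempty
  have f1': "(\<Sum>x\<in>?V. m x * f 1 x) \<noteq> 0" if "c = 0"
    using f1[OF that] by (auto simp: graph_average_def)
  assume "\<not> ?thesis"
  then have "\<forall>k::nat. \<exists>u. (\<forall>x\<in>?V. - ?lap u x = (\<Sum>i = 1..n. f i x * exp (real i * u x)) + c)
      \<and> (MAX x\<in>?V. \<bar>u x\<bar>) > real k"
    by (simp only: not_ex not_all not_imp not_le) blast
  from choice[OF this] obtain u :: "nat \<Rightarrow> 'a \<Rightarrow> real" where
    sol: "\<And>k x. x \<in> ?V \<Longrightarrow> - ?lap (u k) x = (\<Sum>i = 1..n. f i x * exp (real i * u k x)) + c"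
    and big: "\<And>k. (MAX x\<in>?V. \<bar>u k x\<bar>) > real k"
    by blast
  define M where "M k = (MAX x\<in>?V. \<bar>u k x\<bar>)" for k
  \<comment> \<open>The strict bound \<open>> real k\<close> gives positivity for every
    \<open>k\<close>, including 0.\<close>
  have Mpos: "M k > 0" for k using big[of k] unfolding M_def by (meson le_less_trans of_nat_0_le_iff)
  have le: "\<bar>u k x / M k\<bar> \<le> 1" if "x \<in> ?V" for k x
  proof -
    have "\<bar>u k x\<bar> \<le> M k" unfolding M_def by (rule Max_ge) (use fin that in auto)
    then show ?thesis using Mpos[of k] by simp
  qed
  \<comment> \<open>This normalisation is what prevents the limit \<open>w\<close> from vanishing
    identically.\<close>
  have attained: "\<exists>x\<in>?V. \<bar>u k x / M k\<bar> = 1" for k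
  proof -
    have "M k \<in> (\<lambda>x. \<bar>u k x\<bar>) ` ?V" unfolding M_def by (rule Max_in) (use fin ne in auto)
    then show ?thesis using Mpos[of k] by force
  qed
  have Mtop: "filterlim M at_top sequentially"
    by (rule filterlim_at_top_mono[OF filterlim_real_sequentially])
      (use big in \<open>auto simp: M_def less_imp_le\<close>)
  from finite_convergent_subseq[where v = "\<lambda>k x. u k x / M k", OF fin le]
  obtain s where s: "strict_mono s" and conv: "\<forall>x\<in>?V. convergent (\<lambda>k. u (s k) x / M (s k))"
    by blast
  define w where "w x = lim (\<lambda>k. u (s k) x / M (s k))" for x
  have w: "(\<lambda>k. u (s k) x / M (s k)) \<longlonglongrightarrow> w x" if "x \<in> ?V" for x
    using conv that by (simp add: w_def convergent_LIMSEQ_iff)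
  have Ms: "filterlim (\<lambda>k. M (s k)) at_top sequentially"
    by (rule filterlim_compose[OF Mtop filterlim_subseq[OF s]])
  \<comment> \<open>This brings the exponents into the form \<open>M k * v k\<close> of
    \<open>exp_sum_coeffs_zero\<close>.\<close>
  have us: "u (s k) x = M (s k) * (u (s k) x / M (s k))" for k x
    using Mpos[of "s k"] by simp
  have rhs: "(\<lambda>k. ((\<Sum>i = 1..n. f i x * exp (real i * u (s k) x)) + c) / M (s k)) \<longlonglongrightarrow> - ?lap w x"
    if "x \<in> ?V" for x
    using tendsto_minus[OF laplacian_tendsto[OF w that]] sol[OF that, symmetric]
    by (simp add: laplacian_divide)
  have coeffs: "\<forall>i\<in>{1..n}. f i x = 0" if x: "x \<in> ?V" and "w x > 0" for x
    by (rule exp_sum_coeffs_zero[OF Ms w[OF x] \<open>w x > 0\<close>])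
      (use rhs[OF x] us in simp)
  have inv0: "(\<lambda>k. inverse (M (s k))) \<longlonglongrightarrow> 0"
    by (rule tendsto_inverse_0_at_top[OF Ms])
  have lap_pos: "?lap w x = 0" if x: "x \<in> ?V" and "w x > 0" for x
  proof -
    have "(\<lambda>k. c * inverse (M (s k))) \<longlonglongrightarrow> c * 0" by (intro tendsto_intros inv0)
    then have "(\<lambda>k. ((\<Sum>i = 1..n. f i x * exp (real i * u (s k) x)) + c) / M (s k)) \<longlonglongrightarrow> 0"
      using coeffs[OF that] by (simp add: divide_inverse)
    from LIMSEQ_unique[OF rhs[OF x] this] show ?thesis by simp
  qed
  have bot: "filterlim (\<lambda>k. u (s k) x) at_bot sequentially" if x: "x \<in> ?V" and "w x < 0" for x
    using filterlim_tendsto_neg_mult_at_bot[OF w[OF x] \<open>w x < 0\<close> Ms] Mpos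
    by (simp add: less_imp_neq[THEN not_sym])
  have lap_neg: "?lap w x = 0" if x: "x \<in> ?V" and "w x < 0" for x
  proof -
    have "(\<lambda>k. exp (real i * u (s k) x)) \<longlonglongrightarrow> 0" if "i > 0" for i
      by (rule filterlim_compose[OF exp_at_bot])
        (rule filterlim_tendsto_pos_mult_at_bot[OF tendsto_const _ bot[OF x \<open>w x < 0\<close>]], use that in auto)
    then have "(\<lambda>k. ((\<Sum>i = 1..n. f i x * exp (real i * u (s k) x)) + c) * inverse (M (s k)))
        \<longlonglongrightarrow> ((\<Sum>i = 1..n. f i x * 0) + c) * 0"
      by (intro tendsto_intros inv0) auto
    from LIMSEQ_unique[OF rhs[OF x, unfolded divide_inverse] this] show ?thesis by simp
  qed
  \<comment> \<open>The first two cases overlap. A sign-changing \<open>w\<close> does no harm: each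
    extremum principle needs harmonicity only at the extremal value, which has the right
    sign.\<close>
  consider (pos) "\<exists>x\<in>?V. w x > 0" | (neg) "\<exists>x\<in>?V. w x < 0" | (zero) "\<forall>x\<in>?V. w x = 0"
    by (meson linorder_neqE)
  then show False
  proof cases
    case pos
    have "Max (w ` ?V) \<in> w ` ?V" by (rule Max_in) (use fin ne in auto)
    then obtain x where x: "x \<in> ?V" and wx: "Max (w ` ?V) = w x" by blast
    have ext: "w y \<le> w x" if "y \<in> ?V" for y
      unfolding wx[symmetric] by (rule Max_ge) (use fin that in auto)
    obtain z where "z \<in> ?V" "w z > 0" using pos by blast
    with ext[of z] have "w x > 0" by simp
    then have "w y > 0" if "y \<in> ?V" for y
      using maximum_principle[of x y w, OF x that ext] lap_pos by simp
    then have f0: "f i y = 0" if "y \<in> ?V" "i \<in> {1..n}" for y i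
      using coeffs that by blast
    \<comment> \<open>With all coefficients 0 any single solution, here \<open>u 0\<close>,
      satisfies \<open>- ?lap (u 0) y = c\<close>, and integrating gives
      \<open>c = 0\<close>.\<close>
    have "(\<Sum>y\<in>?V. m y * c) = - (\<Sum>y\<in>?V. m y * ?lap (u 0) y)"
      unfolding sum_negf[symmetric]
    proof (rule sum.cong)
      fix y assume "y \<in> ?V"
      then have "- ?lap (u 0) y = c" using sol[of y 0] f0 by simp
      then show "m y * c = - (m y * ?lap (u 0) y)" by auto
    qed simp
    then have "c = 0"
      using total_weight_pos by (simp add: sum_laplacian sum_distrib_right[symmetric])
    moreover have "(\<Sum>y\<in>?V. m y * f 1 y) = 0" using f0 n by simp
    ultimately show False using f1' by simp
  next
    case neg
    have "Min (w ` ?V) \<in> w ` ?V" by (rule Min_in) (use fin ne in auto)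
    then obtain x where x: "x \<in> ?V" and wx: "Min (w ` ?V) = w x" by blast
    have ext: "w x \<le> w y" if "y \<in> ?V" for y
      unfolding wx[symmetric] by (rule Min_le) (use fin that in auto)
    obtain z where "z \<in> ?V" "w z < 0" using neg by blast
    with ext[of z] have "w x < 0" by simp
    then have "w y < 0" if "y \<in> ?V" for y
      using minimum_principle[of x y w, OF x that ext] lap_neg by simp
    then have "filterlim (\<lambda>k. u (s k) y) at_bot sequentially" if "y \<in> ?V" for y
      using bot that by blast
    with no_solutions_to_at_bot[where u = "\<lambda>k. u (s k)", OF sol _ n] f1'
    show False by blast
  next
    case zero
    \<comment> \<open>Finitely many vertices make the convergence to 0 uniform, against the value 1
      attained for each \<open>k\<close>.\<close>
    have "\<forall>\<^sub>F k in sequentially. \<bar>u (s k) x / M (s k)\<bar> < 1" if "x \<in> ?V" for x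
      using order_tendstoD(2)[OF tendsto_rabs[OF w[OF that]], of 1] zero that by simp
    then have "\<forall>\<^sub>F k in sequentially. \<forall>x\<in>?V. \<bar>u (s k) x / M (s k)\<bar> < 1"
      by (simp add: eventually_ball_finite[OF fin])
    then obtain k where "\<forall>x\<in>?V. \<bar>u (s k) x / M (s k)\<bar> < 1"
      using eventually_happens trivial_limit_sequentially by blast
    then show False using attained[of "s k"] by force
  qed
qed

end

theorem corollary1p3:
  fixes G :: "'a pair_pre_digraph"
    and \<omega> :: "'a \<Rightarrow> 'a \<Rightarrow> real"
    and m :: "'a \<Rightarrow> real"
    and n :: nat
    and f :: "nat \<Rightarrow> 'a \<Rightarrow> real"
    and c :: real
  assumes "finite_connected_weighted_graph G \<omega> m"
    and "n > 0"
    and "c = 0 \<Longrightarrow> graph_average G m (f 1) \<noteq> 0"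
  shows "\<exists>C. \<forall>u :: 'a \<Rightarrow> real.
    (\<forall>x \<in> pverts G. - graph_laplacian G \<omega> m u x = (\<Sum>i = 1..n. f i x * exp (real i * u x)) + c)
    \<longrightarrow> (MAX x \<in> pverts G. \<bar>u x\<bar>) \<le> C"
proof -
  interpret finite_connected_weighted_graph G \<omega> m by fact
  show ?thesis using assms(2,3) by (rule solutions_bounded)
qed

end
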